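(* Let $k$ and $\ell$ be positive integers with $\ell$ odd. Let $s$ be a positive integer with $s\not\equiv 1\pmod 3$, and set $M=F_{50s+25}$. Then there exist infinitely many primes $p$ such that $\gcd(k^2-p^\ell, M)=1$.
   Context: $F_n$ denotes the $n$-th Fibonacci number: $F_1=1$, $F_2=1$, $F_{n+2}=F_{n+1}+F_n$ for $n\geq 1$. *)

theory Defs
  imports "HOL-Number_Theory.Number_Theory"
begin

end

theory Submission imports Defs begin

text \<open>
  The index \<open>50 * s + 25\<close> is not divisible by 3, so \<open>M\<close> is odd. If a prime \<open>p\<close> is a quadratic
  nonresidue modulo every prime \<open>q\<close> dividing \<open>M\<close>, then so is \<open>p ^ l\<close> for odd \<open>l\<close>, hence no such \<open>q\<close>
  divides \<open>k\<^sup>2 - p ^ l\<close>. It remains to find infinitely many such primes. This needs only the part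
  of Dirichlet's theorem about real characters. On prime powers \<open>n\<close>, the product over \<open>q\<close> of
  \<open>1 - Legendre n q\<close> vanishes unless \<open>n\<close> is a power of a wanted prime or of some \<open>q\<close>. Expanding it gives a
  signed sum of products of Legendre symbols. Weighted with \<open>mangoldt n / n\<close> and summed over \<open>n \<le> N\<close>, the
  empty product contributes at least \<open>ln N - 1\<close>, and every other product \<open>\<chi>\<close> contributes \<open>O(1)\<close> because
  the series \<open>\<Sum>n. \<chi> n / n\<close> has a nonzero value. So the wanted primes cannot be finite in number.
\<close>

section \<open>Rearranging divisor sums, and partial summation\<close>

lemma sum_divisors_swap:
  fixes f :: "nat \<Rightarrow> nat \<Rightarrow> 'a :: comm_monoid_add"
  shows "(\<Sum>n=1..N. \<Sum>d | d dvd n. f d (n div d)) = (\<Sum>d=1..N. \<Sum>e=1..N div d. f d e)"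
proof -
  have divisor_le: "d \<le> N" if "d dvd n" "0 < n" "n \<le> N" for d n :: nat
    using dvd_imp_le[OF that(1,2)] that(3) by simp
  have "(\<Sum>n=1..N. \<Sum>d | d dvd n. f d (n div d)) =
      (\<Sum>(n, d)\<in>(SIGMA n:{1..N}. {d. d dvd n}). f d (n div d))"
    by (subst sum.Sigma) auto
  also have "\<dots> = (\<Sum>(d, e)\<in>(SIGMA d:{1..N}. {1..N div d}). f d e)"
    by (rule sum.reindex_bij_witness[where i = "\<lambda>(d, e). (d * e, d)" and j = "\<lambda>(n, d). (d, n div d)"])
       (use dvd_pos_nat divisor_le in
         \<open>auto simp: div_le_mono Suc_le_eq div_greater_zero_iff less_eq_div_iff_mult_less_eq mult.commute\<close>)
  also have "\<dots> = (\<Sum>d=1..N. \<Sum>e=1..N div d. f d e)"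
    by (subst sum.Sigma) auto
  finally show ?thesis .
qed

lemma summation_by_parts:
  fixes c g :: "nat \<Rightarrow> real"
  assumes "a \<le> b"
  shows "(\<Sum>k=a..<b. c k * g k) =
    (\<Sum>k<b. c k) * g b - (\<Sum>k<a. c k) * g a + (\<Sum>k=a..<b. (\<Sum>i<Suc k. c i) * (g k - g (Suc k)))"
  using assms by (induction b rule: dec_induct) (simp_all add: algebra_simps)

text \<open>Dirichlet's test with an explicit constant: the boundary terms cost at most
  \<open>C * g b\<close> and \<open>C * g a\<close>, and the remaining sum telescopes to
  \<open>C * (g a - g b)\<close>.\<close>

lemma abs_sum_mult_decseq_le:
  fixes c g :: "nat \<Rightarrow> real"
  assumes C: "\<And>n. \<bar>\<Sum>k<n. c k\<bar> \<le> C"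
    and mono: "\<And>k. a \<le> k \<Longrightarrow> g (Suc k) \<le> g k"
    and nonneg: "\<And>k. a \<le> k \<Longrightarrow> 0 \<le> g k"
  shows "\<bar>\<Sum>k=a..<b. c k * g k\<bar> \<le> 2 * C * g a"
proof (cases "a \<le> b")
  case False
  then show ?thesis
    using C[of 0] nonneg[of a] by simp
next
  case True
  have 1: "\<bar>(\<Sum>k<b. c k) * g b\<bar> \<le> C * g b" "\<bar>(\<Sum>k<a. c k) * g a\<bar> \<le> C * g a"
    using C nonneg True by (auto simp: abs_mult intro!: mult_right_mono)
  have "\<bar>\<Sum>k=a..<b. (\<Sum>i<Suc k. c i) * (g k - g (Suc k))\<bar> \<le> (\<Sum>k=a..<b. C * (g k - g (Suc k)))"
    using C mono C[of 0]
    by (intro order_trans[OF sum_abs] sum_mono) (auto simp: abs_mult simp del: sum.lessThan_Suc intro!: mult_mono)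
  also have "\<dots> = C * (g a - g b)"
    using sum_Suc_diff'[OF True, of g]
    by (simp only: sum_distrib_left[symmetric] sum_subtractf) simp
  finally show ?thesis
    unfolding summation_by_parts[OF True] right_diff_distrib using 1 by linarith
qed

section \<open>Chebyshev's and Mertens' bounds\<close>

lemma sum_ln_eq_sum_mangoldt:
  "(\<Sum>n=1..N. ln (real n)) = (\<Sum>d=1..N. mangoldt d * real (N div d))"
proof -
  have "(\<Sum>n=1..N. ln (real n)) = (\<Sum>n=1..N. \<Sum>d | d dvd n. mangoldt d)"
    by (intro sum.cong) (auto simp: mangoldt_sum)
  also have "\<dots> = (\<Sum>d=1..N. \<Sum>e=1..N div d. mangoldt d)"
    by (rule sum_divisors_swap)
  finally show ?thesis by (simp add: mult.commute)
qed

text \<open>Chebyshev's argument: weighting \<open>mangoldt d\<close> by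
  \<open>2 * n div d - 2 * (n div d)\<close> gives the logarithm of the central binomial
  coefficient, which is at most 4 to the power \<open>n\<close>. The weight is never negative and
  equals 1 for \<open>n < d \<le> 2 * n\<close>.\<close>

lemma sum_mangoldt_double:
  "(\<Sum>d=1..2*n. mangoldt d :: real) \<le> (\<Sum>d=1..n. mangoldt d) + 2 * real n"
proof -
  have fact: "(\<Sum>k=1..m. ln (real k)) = ln (fact m)" for m
    by (induction m) (auto simp: ln_mult)
  have "(\<Sum>d=n+1..2*n. mangoldt d :: real) \<le>
      (\<Sum>d=1..2*n. mangoldt d * (real (2 * n div d) - 2 * real (n div d)))"
  proof -
    have "(\<Sum>d=n+1..2*n. mangoldt d :: real) =
        (\<Sum>d=n+1..2*n. mangoldt d * (real (2 * n div d) - 2 * real (n div d)))"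
    proof (intro sum.cong refl)
      fix d assume d: "d \<in> {n+1..2*n}"
      have "2 * n div d = 1"
        using d by (intro div_nat_eqI) auto
      then show "(mangoldt d :: real) = mangoldt d * (real (2 * n div d) - 2 * real (n div d))"
        using d by simp
    qed
    also have "\<dots> \<le> (\<Sum>d=1..2*n. mangoldt d * (real (2 * n div d) - 2 * real (n div d)))"
    proof (intro sum_mono2)
      fix d :: nat
      have "2 * (n div d) \<le> 2 * n div d"
        by (cases "d = 0") (auto simp: less_eq_div_iff_mult_less_eq)
      then have "2 * real (n div d) \<le> real (2 * n div d)"
        by (metis of_nat_le_iff of_nat_mult of_nat_numeral)
      then show "0 \<le> (mangoldt d :: real) * (real (2 * n div d) - 2 * real (n div d))"
        by (simp add: mangoldt_nonneg)
    qed auto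
    finally show ?thesis .
  qed
  also have "\<dots> = (\<Sum>k=1..2*n. ln (real k)) - 2 * (\<Sum>k=1..n. ln (real k))"
  proof -
    \<comment> \<open>The range can be doubled because \<open>n div d = 0\<close> for
      \<open>d > n\<close>.\<close>
    have "2 * (\<Sum>d=1..n. mangoldt d * real (n div d)) = (\<Sum>d=1..2*n. mangoldt d * (2 * real (n div d)))"
      unfolding sum_distrib_left mult.left_commute[of 2] by (intro sum.mono_neutral_left) auto
    then show ?thesis
      unfolding sum_ln_eq_sum_mangoldt right_diff_distrib sum_subtractf by simp
  qed
  also have "\<dots> = ln (real ((2 * n) choose n))"
  proof -
    have "2 * n - n = n" by simp
    then have "real ((2 * n) choose n) = fact (2 * n) / (fact n * fact n)"
      using binomial_fact[of n "2 * n", where 'a = real] by simp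
    then show ?thesis
      unfolding fact by (simp add: ln_div ln_mult)
  qed
  also have "\<dots> \<le> ln (2 ^ (2 * n))"
  proof -
    have "real ((2 * n) choose n) \<le> real (2 ^ (2 * n))"
      unfolding of_nat_le_iff by (rule binomial_le_pow2)
    moreover have "0 < real ((2 * n) choose n)"
      by simp
    ultimately show ?thesis by (simp only: of_nat_power of_nat_numeral ln_mono)
  qed
  also have "\<dots> \<le> 2 * real n"
    using ln_2_less_1 by (simp add: ln_realpow mult_left_le)
  finally have "(\<Sum>d=n+1..2*n. mangoldt d :: real) \<le> 2 * real n" .
  moreover have "(\<Sum>d=1..2*n. mangoldt d :: real) = (\<Sum>d=1..n. mangoldt d) + (\<Sum>d=n+1..2*n. mangoldt d)"
    by (subst sum.union_disjoint[symmetric]) (auto intro!: sum.cong)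
  ultimately show ?thesis by linarith
qed

text \<open>Halving: with \<open>n = N div 2\<close>, the bounds \<open>4 * n\<close> and
  \<open>2 * n\<close> add up to \<open>6 * n\<close>, and for odd \<open>N\<close> the last term
  adds at most \<open>ln N \<le> 2 * n\<close>.\<close>

lemma sum_mangoldt_le: "(\<Sum>d=1..N. mangoldt d :: real) \<le> 4 * real N"
proof (induction N rule: less_induct)
  case (less N)
  show ?case
  proof (cases "N \<le> 1")
    case True
    then show ?thesis by (cases N) auto
  next
    case False
    define n where "n = N div 2"
    have IH: "(\<Sum>d=1..n. mangoldt d :: real) \<le> 4 * real n"
      using False by (intro less) (auto simp: n_def)
    have dbl: "(\<Sum>d=1..2*n. mangoldt d :: real) \<le> 6 * real n"
      using IH sum_mangoldt_double[of n] by linarith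
    show ?thesis
    proof (cases "even N")
      case True
      then have "N = 2 * n" by (simp add: n_def)
      then show ?thesis using dbl by simp
    next
      case False
      then have N: "N = Suc (2 * n)" by (simp add: n_def)
      have "mangoldt N \<le> ln (real N)"
        by (rule mangoldt_le) (simp add: N)
      also have "\<dots> \<le> 2 * real n"
        using ln_le_minus_one[of "real N"] by (simp add: N)
      finally show ?thesis using dbl by (simp add: N)
    qed
  qed
qed

text \<open>The factorial identity with \<open>N div d\<close> enlarged to \<open>N / d\<close>,
  compared with the lower Stirling bound \<open>N * ln N - N\<close> for the logarithm of the
  factorial.\<close>

lemma sum_mangoldt_over_ge:
  assumes "N > 0"
  shows "ln (real N) - 1 \<le> (\<Sum>d=1..N. mangoldt d / real d)"
proof -
  have fact: "real n * ln (real n) - real n \<le> (\<Sum>k=1..n. ln (real k))" for n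
  proof (induction n)
    case (Suc n)
    have "real n * (ln (real (Suc n)) - ln (real n)) \<le> 1"
    proof (cases "n = 0")
      case False
      have "ln (real (Suc n)) - ln (real n) = ln (1 + 1 / real n)"
      proof -
        have "1 + 1 / real n = real (Suc n) / real n"
          using False by (simp add: field_simps)
        then show ?thesis
          using False by (simp add: ln_div)
      qed
      also have "\<dots> \<le> 1 / real n"
        by (rule ln_add_one_self_le_self) simp
      finally show ?thesis using False by (simp add: field_simps)
    qed auto
    then show ?case using Suc by (simp add: algebra_simps)
  qed simp
  have "(\<Sum>k=1..N. ln (real k)) \<le> (\<Sum>d=1..N. mangoldt d * (real N / real d))"
    unfolding sum_ln_eq_sum_mangoldt
    by (intro sum_mono mult_left_mono mangoldt_nonneg) (rule of_nat_div_le_of_nat)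
  also have "\<dots> = real N * (\<Sum>d=1..N. mangoldt d / real d)"
    by (simp add: sum_distrib_left field_simps)
  finally have "real N * (ln (real N) - 1) \<le> real N * (\<Sum>d=1..N. mangoldt d / real d)"
    using fact[of N] by (simp add: algebra_simps)
  then show ?thesis using assms by simp
qed

text \<open>The powers of one prime \<open>p\<close> contribute at most \<open>ln p\<close> times a
  geometric series with value \<open>1 / (p - 1) \<le> 1\<close>. What matters later is that the
  bound is independent of \<open>N\<close>.\<close>

lemma sum_mangoldt_over_primepow_le:
  assumes "finite S" "\<And>p. p \<in> S \<Longrightarrow> prime p"
  shows "(\<Sum>n | n \<in> {1..N} \<and> primepow n \<and> aprimedivisor n \<in> S. mangoldt n / real n) \<le> (\<Sum>p\<in>S. ln (real p))"
proof -
  let ?f = "\<lambda>(p, k). p ^ k :: nat"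
  let ?A = "{n \<in> {1..N}. primepow n \<and> aprimedivisor n \<in> S}"
  have sub: "?A \<subseteq> ?f ` (S \<times> {1..N})"
  proof
    fix n assume n: "n \<in> ?A"
    then obtain p k where pk: "prime p" "k > 0" "n = p ^ k"
      by (auto simp: primepow_def)
    \<comment> \<open>Since \<open>p ^ k \<le> N\<close>, this bounds the exponent by
      \<open>N\<close> as well, so finitely many pairs suffice.\<close>
    have "k < p ^ k"
      using prime_gt_1_nat[OF pk(1)] by (simp add: power_gt_expt)
    then have "(p, k) \<in> S \<times> {1..N}"
      using n pk by (auto simp: aprimedivisor_prime_power)
    then show "n \<in> ?f ` (S \<times> {1..N})"
      using pk(3) by force
  qed
  have "(\<Sum>n\<in>?A. mangoldt n / real n) \<le> (\<Sum>n\<in>?f ` (S \<times> {1..N}). mangoldt n / real n)"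
    using assms(1) sub by (intro sum_mono2) (auto simp: mangoldt_nonneg)
  also have "\<dots> \<le> (\<Sum>x\<in>S \<times> {1..N}. mangoldt (?f x) / real (?f x))"
    using assms(1) sum_image_le[of "S \<times> {1..N}" "\<lambda>n. mangoldt n / real n :: real" ?f]
    by (auto simp: mangoldt_nonneg o_def)
  also have "\<dots> = (\<Sum>p\<in>S. \<Sum>k=1..N. mangoldt (p ^ k) / real (p ^ k))"
    by (simp add: sum.cartesian_product case_prod_unfold)
  also have "\<dots> \<le> (\<Sum>p\<in>S. ln (real p))"
  proof (intro sum_mono)
    fix p assume "p \<in> S"
    then have p: "prime p" using assms by auto
    have p2: "real p \<ge> 2" using prime_ge_2_nat[OF p] by simp
    have geo: "(\<Sum>k=1..n. (1 / real p) ^ k) \<le> 1 - (1 / real p) ^ n" for n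
    proof (induction n)
      case (Suc n)
      have "2 * (1 / real p) ^ Suc n \<le> (1 / real p) ^ n"
        using p2 by (simp add: field_simps)
      then show ?case using Suc by simp
    qed simp
    have "(\<Sum>k=1..N. mangoldt (p ^ k) / real (p ^ k)) = ln (real p) * (\<Sum>k=1..N. (1 / real p) ^ k)"
      using p by (auto simp: sum_distrib_left power_one_over field_simps intro!: sum.cong)
    also have "\<dots> \<le> ln (real p) * 1"
    proof (intro mult_left_mono)
      show "(\<Sum>k=1..N. (1 / real p) ^ k) \<le> 1"
        using geo[of N] p2 by (smt (verit) zero_le_divide_1_iff zero_le_power)
    qed (use p2 in simp)
    finally show "(\<Sum>k=1..N. mangoldt (p ^ k) / real (p ^ k)) \<le> ln (real p)" by simp
  qed
  finally show ?thesis .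
qed

section \<open>Real characters with bounded partial sums\<close>

lemma sum_divisors_prime_power:
  fixes f :: "nat \<Rightarrow> real"
  assumes mult: "\<And>m n. f (m * n) = f m * f n" and p: "prime p" "\<not> p dvd m" and "m > 0"
  shows "(\<Sum>d | d dvd p ^ k * m. f d) = (\<Sum>i\<le>k. f p ^ i) * (\<Sum>d | d dvd m. f d)"
proof (induction k)
  case (Suc k)
  have p0: "p > 0" using prime_gt_0_nat[OF p(1)] .
  \<comment> \<open>Divisors divisible by \<open>p\<close> are \<open>p\<close> times a divisor of
    \<open>p ^ k * m\<close>; the others are coprime to \<open>p\<close> and divide
    \<open>m\<close>. This builds the geometric sum in Horner form.\<close>
  have eq: "{d. d dvd p ^ Suc k * m} = (\<lambda>d. p * d) ` {d. d dvd p ^ k * m} \<union> {d. d dvd m}"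
  proof (intro equalityI subsetI)
    fix d assume d: "d \<in> {d. d dvd p ^ Suc k * m}"
    show "d \<in> (\<lambda>d. p * d) ` {d. d dvd p ^ k * m} \<union> {d. d dvd m}"
    proof (cases "p dvd d")
      case True
      then obtain e where "d = p * e" by (rule dvdE)
      then show ?thesis using d p0 by (auto simp: mult.assoc)
    next
      case False
      then have "coprime d (p ^ Suc k)"
        using prime_imp_coprime[OF p(1)] by (simp add: coprime_commute)
      then show ?thesis using d by (simp add: coprime_dvd_mult_right_iff del: power_Suc)
    qed
  qed (auto simp: mult.assoc intro: dvd_mult)
  have fin: "finite {d. d dvd p ^ k * m}" "finite {d. d dvd m}"
    using p0 \<open>m > 0\<close> by auto
  have "(\<Sum>d | d dvd p ^ Suc k * m. f d) = (\<Sum>d\<in>(\<lambda>d. p * d) ` {d. d dvd p ^ k * m}. f d) + (\<Sum>d | d dvd m. f d)"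
    unfolding eq using fin p by (intro sum.union_disjoint) (auto dest: dvd_mult_left)
  also have "(\<Sum>d\<in>(\<lambda>d. p * d) ` {d. d dvd p ^ k * m}. f d) = f p * (\<Sum>d | d dvd p ^ k * m. f d)"
    using p0 by (subst sum.reindex) (auto simp: inj_on_def mult sum_distrib_left)
  finally show ?case
    unfolding Suc.IH sum.atMost_Suc_shift by (simp add: algebra_simps flip: sum_distrib_left)
qed simp

lemma geometric_sum_sign:
  fixes x :: real
  assumes "x \<in> {-1, 0, 1}"
  shows "0 \<le> (\<Sum>i\<le>k. x ^ i)" and "even k \<Longrightarrow> 1 \<le> (\<Sum>i\<le>k. x ^ i)"
proof -
  have "(\<Sum>i\<le>k. (-1 :: real) ^ i) = (if even k then 1 else 0)"
    by (induction k) auto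
  moreover have "(\<Sum>i\<le>k. (0 :: real) ^ i) = 1"
    by (induction k) auto
  ultimately show "0 \<le> (\<Sum>i\<le>k. x ^ i)" "even k \<Longrightarrow> 1 \<le> (\<Sum>i\<le>k. x ^ i)"
    using assms by auto
qed

text \<open>The extra factor \<open>u\<close> on the right avoids the truncated exponent \<open>n - 1\<close> on the left.\<close>

lemma power_le_geometric_sum:
  fixes u :: real
  assumes "0 \<le> u"
  shows "real n * u ^ n \<le> u * (\<Sum>i<n. (u\<^sup>2) ^ i)"
proof (induction n rule: induct_nat_012)
  case (ge2 n)
  \<comment> \<open>Induction in steps of two: the first and last terms give
    \<open>2 * u ^ Suc n\<close> by the arithmetic-geometric mean inequality, and the inner terms
    are the shorter sum times \<open>u\<^sup>2\<close>.\<close>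
  have "(\<Sum>i<Suc (Suc n). (u\<^sup>2) ^ i) = 1 + u\<^sup>2 * (\<Sum>i<n. (u\<^sup>2) ^ i) + (u\<^sup>2) ^ Suc n"
    by (simp only: sum.lessThan_Suc_shift[of _ "n"] sum.lessThan_Suc[of _ "Suc n"]) (simp add: sum_distrib_left)
  moreover have "2 * u ^ Suc n \<le> 1 + (u\<^sup>2) ^ Suc n"
    using sum_squares_bound[of 1 "u ^ Suc n"] by (simp only: power_mult[symmetric] mult.commute[of 2]) simp
  ultimately have "u * (2 * u ^ Suc n + u\<^sup>2 * (\<Sum>i<n. (u\<^sup>2) ^ i)) \<le> u * (\<Sum>i<Suc (Suc n). (u\<^sup>2) ^ i)"
    using assms by (intro mult_left_mono) auto
  moreover have "u\<^sup>2 * (real n * u ^ n) \<le> u\<^sup>2 * (u * (\<Sum>i<n. (u\<^sup>2) ^ i))"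
    using ge2.IH(1) by (intro mult_left_mono) auto
  ultimately show ?case
    by (simp add: algebra_simps power2_eq_square)
qed auto

text \<open>Writing \<open>1 - t ^ n = (1 - t) * S n\<close> with \<open>S\<close> the geometric
  sum, the claims reduce to \<open>n * t ^ n \<le> S n\<close> and
  \<open>t ^ n / (S n * S (Suc n)) \<le> 1 / (n * Suc n)\<close>.\<close>

lemma lambert_term_mono:
  fixes t :: real
  assumes t: "0 < t" "t < 1" and n: "n > 0"
  shows "t ^ n / (1 - t ^ n) \<le> 1 / (real n * (1 - t))"
    and "1 / (real (Suc n) * (1 - t)) - t ^ Suc n / (1 - t ^ Suc n) \<le> 1 / (real n * (1 - t)) - t ^ n / (1 - t ^ n)"
proof -
  \<comment> \<open>The square root splits \<open>t ^ n\<close> as \<open>u ^ n * u ^ n\<close>, one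
    factor for each of the bounds \<open>AM1\<close> and \<open>AM2\<close>.\<close>
  define u where "u = sqrt t"
  have u: "0 < u" "u < 1" "u\<^sup>2 = t" using t by (auto simp: u_def)
  define S where "S = (\<lambda>n. \<Sum>i<n. t ^ i)"
  have diff: "1 - t ^ m = (1 - t) * S m" for m
    unfolding S_def by (rule one_diff_power_eq)
  have S_Suc: "S (Suc n) = 1 + t * S n"
    unfolding S_def sum.lessThan_Suc_shift by (simp add: sum_distrib_left)
  have Spos: "S m > 0" if "m > 0" for m
    unfolding S_def using that t by (intro sum_pos) auto
  have AM: "real m * u ^ m \<le> u * S m" for m
    using power_le_geometric_sum[of u m] u by (simp add: S_def)
  have tn: "t ^ n = u ^ n * u ^ n"
    using u(3) by (simp add: power2_eq_square power_mult_distrib flip: u(3))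
  have AM1: "real n * u ^ n \<le> S n"
    using AM[of n] u Spos[OF n] mult_right_mono[of u 1 "S n"] by linarith
  have AM2: "real (Suc n) * u ^ n \<le> S (Suc n)"
    using AM[of "Suc n"] u by (simp only: power_Suc mult.left_commute[of _ u] mult_le_cancel_left_pos)
  have "real n * t ^ n \<le> real n * u ^ n"
    unfolding tn using u by (intro mult_left_mono) (auto simp: power_le_one mult_left_le)
  with AM1 have "real n * t ^ n \<le> S n" by linarith
  then show "t ^ n / (1 - t ^ n) \<le> 1 / (real n * (1 - t))"
    unfolding diff using Spos[OF n] t n by (simp add: divide_simps mult.commute mult.left_commute)
  have "(real n * u ^ n) * (real (Suc n) * u ^ n) \<le> S n * S (Suc n)"
    using AM1 AM2 Spos[OF n] u by (intro mult_mono) auto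
  then have key: "t ^ n / (S n * S (Suc n)) \<le> 1 / (real n * real (Suc n))"
    unfolding tn using Spos[OF n] Spos[of "Suc n"] n by (simp add: divide_simps mult.commute mult.left_commute)
  have "t ^ n / S n - t ^ Suc n / S (Suc n) = t ^ n * (S (Suc n) - t * S n) / (S n * S (Suc n))"
    using Spos[OF n] Spos[of "Suc n"] by (simp add: field_simps)
  also have "\<dots> = t ^ n / (S n * S (Suc n))"
    by (simp add: S_Suc)
  also have "\<dots> \<le> 1 / (real n * real (Suc n))" by (rule key)
  also have "\<dots> = 1 / real n - 1 / real (Suc n)"
    using n by (simp add: field_simps)
  finally have "(1 / real (Suc n) - t ^ Suc n / S (Suc n)) / (1 - t) \<le> (1 / real n - t ^ n / S n) / (1 - t)"
    using t by (intro divide_right_mono) auto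
  then show "1 / (real (Suc n) * (1 - t)) - t ^ Suc n / (1 - t ^ Suc n) \<le> 1 / (real n * (1 - t)) - t ^ n / (1 - t ^ n)"
    unfolding diff by (simp add: diff_divide_distrib mult.commute)
qed

text \<open>No modulus appears: periodicity and the vanishing sum over a period enter only through
  \<open>sum_bounded\<close>.\<close>

locale real_character =
  fixes \<chi> :: "nat \<Rightarrow> real" and C :: real
  assumes one: "\<chi> 1 = 1"
    and mult: "\<chi> (m * n) = \<chi> m * \<chi> n"
    and range: "\<chi> n \<in> {-1, 0, 1}"
    and sum_bounded: "\<bar>\<Sum>k<n. \<chi> k\<bar> \<le> C"
begin

lemma abs_le_1: "\<bar>\<chi> n\<bar> \<le> 1"
  using range[of n] by auto

lemma C_nonneg: "0 \<le> C"
  using sum_bounded[of 0] by simp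

lemma abs_sum_le:
  assumes "\<And>k. a \<le> k \<Longrightarrow> g (Suc k) \<le> g k" "\<And>k. a \<le> k \<Longrightarrow> 0 \<le> g k"
  shows "\<bar>\<Sum>k=a..<b. \<chi> k * g k\<bar> \<le> 2 * C * g a"
  using sum_bounded assms by (rule abs_sum_mult_decseq_le)

text \<open>Both divisor sums factor over primes into geometric sums in \<open>\<chi> p\<close>.
  None of these is negative, and for a square the exponents are even, so each factor is at least
  1.\<close>

lemma divisor_sum:
  assumes "n > 0"
  shows "0 \<le> (\<Sum>d | d dvd n. \<chi> d)" and "1 \<le> (\<Sum>d | d dvd n\<^sup>2. \<chi> d)"
proof -
  have "0 \<le> (\<Sum>d | d dvd n. \<chi> d) \<and> 1 \<le> (\<Sum>d | d dvd n\<^sup>2. \<chi> d)"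
    using assms
  proof (induction n rule: less_induct)
    case (less n)
    show ?case
    proof (cases "n = 1")
      case True
      then show ?thesis using one by simp
    next
      case False
      then obtain p where p: "prime p" "p dvd n" using prime_factor_nat by blast
      obtain m where m: "n = p ^ multiplicity p n * m" "\<not> p dvd m"
        using multiplicity_decompose'[of n p] less.prems p(1) not_prime_unit by blast
      define k where "k = multiplicity p n"
      have n: "n = p ^ k * m" using m(1) by (simp add: k_def)
      have m0: "m > 0" using n less.prems by (intro Nat.gr0I) auto
      have "m \<noteq> n" using p m(2) by auto
      moreover have "m \<le> n" using n less.prems by (intro dvd_imp_le) auto
      ultimately have IH: "0 \<le> (\<Sum>d | d dvd m. \<chi> d)" "1 \<le> (\<Sum>d | d dvd m\<^sup>2. \<chi> d)"
        using less.IH[of m] m0 by auto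
      have 1: "(\<Sum>d | d dvd n. \<chi> d) = (\<Sum>i\<le>k. \<chi> p ^ i) * (\<Sum>d | d dvd m. \<chi> d)"
        unfolding n using mult p(1) m(2) m0 by (rule sum_divisors_prime_power)
      have "n\<^sup>2 = p ^ (2 * k) * m\<^sup>2"
        unfolding n by (simp add: power_mult_distrib power_mult[symmetric] mult.commute)
      moreover have "\<not> p dvd m\<^sup>2"
        using m(2) p(1) prime_dvd_power by blast
      ultimately have 2: "(\<Sum>d | d dvd n\<^sup>2. \<chi> d) = (\<Sum>i\<le>2*k. \<chi> p ^ i) * (\<Sum>d | d dvd m\<^sup>2. \<chi> d)"
        using sum_divisors_prime_power[of \<chi> p "m\<^sup>2" "2 * k"] mult p(1) m0 by simp
      show ?thesis
        unfolding 1 2 using IH geometric_sum_sign[OF range[of p], of k] geometric_sum_sign[OF range[of p], of "2 * k"]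
          mult_mono[of 1 "\<Sum>i\<le>2*k. \<chi> p ^ i" 1 "\<Sum>d | d dvd m\<^sup>2. \<chi> d"] by auto
    qed
  qed
  then show "0 \<le> (\<Sum>d | d dvd n. \<chi> d)" "1 \<le> (\<Sum>d | d dvd n\<^sup>2. \<chi> d)" by auto
qed

section \<open>The value of the L-series at 1 and its nonvanishing\<close>

definition L1 :: real where "L1 = lim (\<lambda>N. \<Sum>n=1..N. \<chi> n / real n)"

lemma abs_sum_over_le: "\<bar>\<Sum>n=Suc a..b. \<chi> n / real n\<bar> \<le> 2 * C / real (Suc a)"
  using abs_sum_le[of "Suc a" "\<lambda>n. 1 / real n" "Suc b"]
  by (simp add: frac_le atLeastLessThanSuc_atLeastAtMost)

lemma abs_sum_diff_le:
  assumes "a \<le> b"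
  shows "\<bar>(\<Sum>n=1..b. \<chi> n / real n) - (\<Sum>n=1..a. \<chi> n / real n)\<bar> \<le> 2 * C / real (Suc a)"
proof -
  have "(\<Sum>n=1..b. \<chi> n / real n) = (\<Sum>n=1..a. \<chi> n / real n) + (\<Sum>n=Suc a..b. \<chi> n / real n)"
    using assms by (subst sum.union_disjoint[symmetric]) (auto intro!: sum.cong)
  then show ?thesis using abs_sum_over_le[of a b] by simp
qed

lemma L1_tendsto: "(\<lambda>N. \<Sum>n=1..N. \<chi> n / real n) \<longlonglongrightarrow> L1"
proof -
  have "Cauchy (\<lambda>N. \<Sum>n=1..N. \<chi> n / real n)"
  proof (rule CauchyI')
    fix e :: real assume e: "e > 0"
    obtain K where K: "2 * C / e < real K"
      using reals_Archimedean2 by blast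
    have "dist (\<Sum>n=1..a. \<chi> n / real n) (\<Sum>n=1..b. \<chi> n / real n) < e" if "K \<le> a" "a < b" for a b
    proof -
      have "dist (\<Sum>n=1..a. \<chi> n / real n) (\<Sum>n=1..b. \<chi> n / real n) \<le> 2 * C / real (Suc a)"
        using abs_sum_diff_le[of a b] that by (simp add: dist_real_def abs_minus_commute)
      also have "\<dots> < e"
      proof -
        have "2 * C < e * real K" using K e by (simp add: field_simps)
        also have "\<dots> \<le> e * real (Suc a)" using e that by (intro mult_left_mono) auto
        finally show ?thesis by (simp add: field_simps)
      qed
      finally show ?thesis .
    qed
    then show "\<exists>M. \<forall>m\<ge>M. \<forall>n>m. dist (\<Sum>k=1..m. \<chi> k / real k) (\<Sum>k=1..n. \<chi> k / real k) < e"
      by blast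
  qed
  then show ?thesis
    unfolding L1_def by (simp only: Cauchy_convergent_iff convergent_LIMSEQ_iff)
qed

lemma L1_diff_le: "\<bar>L1 - (\<Sum>n=1..a. \<chi> n / real n)\<bar> \<le> 2 * C / real (Suc a)"
proof (rule tendsto_upperbound)
  show "(\<lambda>b. \<bar>(\<Sum>n=1..b. \<chi> n / real n) - (\<Sum>n=1..a. \<chi> n / real n)\<bar>) \<longlonglongrightarrow> \<bar>L1 - (\<Sum>n=1..a. \<chi> n / real n)\<bar>"
    by (intro tendsto_intros L1_tendsto)
  show "\<forall>\<^sub>F b in sequentially. \<bar>(\<Sum>n=1..b. \<chi> n / real n) - (\<Sum>n=1..a. \<chi> n / real n)\<bar> \<le> 2 * C / real (Suc a)"
    using eventually_ge_at_top[of a] by eventually_elim (rule abs_sum_diff_le)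
qed auto

text \<open>
  Monsky's argument: with \<open>r n\<close> the sum of \<open>\<chi>\<close> over the divisors of \<open>n\<close>, the power series
  \<open>\<Sum>n. r n * t ^ n\<close> is unbounded as \<open>t\<close> tends to 1, because \<open>r\<close> is nonnegative and at least 1 at
  squares. It equals the Lambert series \<open>\<Sum>d. \<chi> d * (t ^ d / (1 - t ^ d))\<close>, and if \<open>L1 = 0\<close> then
  subtracting \<open>1 / (d * (1 - t))\<close> from the factor of \<open>\<chi> d\<close> does not change the value but makes the factors
  monotone in \<open>d\<close>, so that partial summation bounds the series uniformly in \<open>t\<close>.
\<close>

lemma L1_nonzero: "L1 \<noteq> 0"
proof
  assume "L1 = 0"
  then have S_lim: "(\<lambda>N. \<Sum>n=1..N. \<chi> n / real n) \<longlonglongrightarrow> 0"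
    using L1_tendsto by simp
  \<comment> \<open>The bound depends on neither \<open>t\<close> nor \<open>K\<close>; letting
    \<open>t\<close> tend to 1 then gives \<open>K \<le> 2 * C\<close> for every
    \<open>K\<close>.\<close>
  have bound: "(\<Sum>m=1..K. t ^ (m\<^sup>2)) \<le> 2 * C" if t: "0 < t" "t < 1" for t :: real and K
  proof -
    define b where "b = (\<lambda>n. 1 / (real n * (1 - t)) - t ^ n / (1 - t ^ n))"
    define S where "S = (\<lambda>N. \<Sum>n=1..N. \<chi> n / real n)"
    \<comment> \<open>A truncated version of the Lambert identity. The condition on \<open>N\<close>
      keeps all squares up to \<open>K\<^sup>2\<close> in range.\<close>
    have upper: "(\<Sum>m=1..K. t ^ (m\<^sup>2)) \<le> S N / (1 - t) + 2 * C + real N * t ^ N / (1 - t)"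
      if N: "K\<^sup>2 \<le> N" for N
    proof -
      have "(\<Sum>m=1..K. t ^ (m\<^sup>2)) \<le> (\<Sum>m=1..K. (\<Sum>d | d dvd m\<^sup>2. \<chi> d) * t ^ (m\<^sup>2))"
        using t divisor_sum(2) by (intro sum_mono) (auto intro!: mult_right_mono[of 1, simplified])
      also have "\<dots> = (\<Sum>n\<in>(\<lambda>m. m\<^sup>2) ` {1..K}. (\<Sum>d | d dvd n. \<chi> d) * t ^ n)"
        by (subst sum.reindex) (auto simp: inj_on_def)
      also have "\<dots> \<le> (\<Sum>n=1..N. (\<Sum>d | d dvd n. \<chi> d) * t ^ n)"
      proof (rule sum_mono2)
        show "(\<lambda>m. m\<^sup>2) ` {1..K} \<subseteq> {1..N}"
          using N order_trans[OF power_mono[of _ K 2] N] by auto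
      qed (use t divisor_sum(1) in \<open>auto intro!: mult_nonneg_nonneg\<close>)
      also have "\<dots> = (\<Sum>n=1..N. \<Sum>d | d dvd n. \<chi> d * t ^ (d * (n div d)))"
        by (auto simp: sum_distrib_right intro!: sum.cong)
      also have "\<dots> = (\<Sum>d=1..N. \<Sum>e=1..N div d. \<chi> d * t ^ (d * e))"
        by (rule sum_divisors_swap)
      also have "\<dots> \<le> (\<Sum>d=1..N. \<chi> d * (t ^ d / (1 - t ^ d)) + t ^ N / (1 - t))"
      proof (rule sum_mono)
        fix d assume d: "d \<in> {1..N}"
        define q where "q = N div d"
        have td: "t ^ d \<le> t" "t ^ d < 1"
          using t d power_decreasing[of 1 d t] by auto
        have geo: "(\<Sum>e=1..q. (t ^ d) ^ e) = t ^ d / (1 - t ^ d) - t ^ (d * Suc q) / (1 - t ^ d)"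
        proof -
          have "(1 - t ^ d) * (\<Sum>e=1..m. (t ^ d) ^ e) = t ^ d - (t ^ d) ^ Suc m" for m
            by (induction m) (simp_all add: distrib_left, simp add: algebra_simps)
          from this[of q] have "(\<Sum>e=1..q. (t ^ d) ^ e) = (t ^ d - (t ^ d) ^ Suc q) / (1 - t ^ d)"
            using td by (simp add: divide_simps mult.commute)
          then show ?thesis by (simp only: diff_divide_distrib power_mult)
        qed
        \<comment> \<open>The geometric series cut off at \<open>q\<close> leaves a tail with
          exponent at least \<open>N\<close>, and \<open>1 - t ^ d \<ge> 1 - t\<close>.\<close>
        have "N \<le> d * Suc q"
          using d dividend_less_times_div[of d N] by (simp add: q_def)
        then have "t ^ (d * Suc q) / (1 - t ^ d) \<le> t ^ N / (1 - t)"
          using t td by (intro frac_le power_decreasing) auto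
        moreover have "\<bar>\<chi> d * (t ^ (d * Suc q) / (1 - t ^ d))\<bar> \<le> 1 * (t ^ (d * Suc q) / (1 - t ^ d))"
          unfolding abs_mult using t td abs_le_1[of d] by (intro mult_mono) auto
        moreover have "(\<Sum>e=1..q. \<chi> d * t ^ (d * e)) =
            \<chi> d * (t ^ d / (1 - t ^ d)) - \<chi> d * (t ^ (d * Suc q) / (1 - t ^ d))"
          using geo by (simp only: power_mult sum_distrib_left[symmetric] right_diff_distrib)
        ultimately show "(\<Sum>e=1..N div d. \<chi> d * t ^ (d * e)) \<le> \<chi> d * (t ^ d / (1 - t ^ d)) + t ^ N / (1 - t)"
          unfolding q_def by linarith
      qed
      also have "\<dots> = S N / (1 - t) - (\<Sum>d=1..N. \<chi> d * b d) + real N * t ^ N / (1 - t)"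
        by (simp add: b_def S_def sum.distrib sum_subtractf sum_divide_distrib right_diff_distrib)
      also have "\<dots> \<le> S N / (1 - t) + 2 * C * b 1 + real N * t ^ N / (1 - t)"
      proof -
        have "\<bar>\<Sum>d=1..<Suc N. \<chi> d * b d\<bar> \<le> 2 * C * b 1"
          unfolding b_def using lambert_term_mono[OF t] by (intro abs_sum_le) auto
        then have "\<bar>\<Sum>d=1..N. \<chi> d * b d\<bar> \<le> 2 * C * b 1"
          by (simp add: atLeastLessThanSuc_atLeastAtMost)
        then show ?thesis by linarith
      qed
      \<comment> \<open>This makes the bound from partial summation independent of
        \<open>t\<close>.\<close>
      also have "b 1 = 1"
        using t by (simp add: b_def diff_divide_distrib[symmetric])
      finally show ?thesis by simp
    qed
    have lim: "(\<lambda>N. S N / (1 - t) + 2 * C + real N * t ^ N / (1 - t)) \<longlonglongrightarrow> 0 / (1 - t) + 2 * C + 0 / (1 - t)"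
      using S_lim t powser_times_n_limit_0[of t] unfolding S_def
      by (intro tendsto_intros) auto
    have "\<forall>\<^sub>F N in sequentially. (\<Sum>m=1..K. t ^ (m\<^sup>2)) \<le> S N / (1 - t) + 2 * C + real N * t ^ N / (1 - t)"
      using eventually_ge_at_top[of "K\<^sup>2"] by eventually_elim (rule upper)
    from tendsto_lowerbound[OF lim this] show ?thesis by simp
  qed
  have "real K \<le> 2 * C" for K
  proof (rule tendsto_upperbound)
    have "((\<lambda>t::real. \<Sum>m=1..K. t ^ (m\<^sup>2)) \<longlongrightarrow> (\<Sum>m=1..K. 1 ^ (m\<^sup>2))) (at_left 1)"
      by (intro tendsto_intros)
    then show "((\<lambda>t::real. \<Sum>m=1..K. t ^ (m\<^sup>2)) \<longlongrightarrow> real K) (at_left 1)"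
      by simp
    show "\<forall>\<^sub>F t::real in at_left 1. (\<Sum>m=1..K. t ^ (m\<^sup>2)) \<le> 2 * C"
      using eventually_at_left_real[OF zero_less_one] by eventually_elim (use bound in auto)
  qed simp
  then show False
    using reals_Archimedean2[of "2 * C"] by (meson not_le)
qed

section \<open>Bounded twisted sums of the logarithm and of the von Mangoldt function\<close>

lemma sum_ln_over_bounded: "\<exists>D. \<forall>N. \<bar>\<Sum>n=1..N. \<chi> n * (ln (real n) / real n)\<bar> \<le> D"
proof -
  let ?f = "\<lambda>n. \<chi> n * (ln (real n) / real n)"
  \<comment> \<open>\<open>ln x / x\<close> decreases only beyond \<open>e\<close>, hence the start
    at 3; the terms for 1 and 2 are kept apart.\<close>
  have dec: "ln (real (Suc k)) / real (Suc k) \<le> ln (real k) / real k" if k: "3 \<le> k" for k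
  proof -
    have "1 \<le> ln (real k)"
      using k exp_le by (subst ln_ge_iff) auto
    moreover have "ln (real (Suc k)) \<le> ln (real k) + 1 / real k"
    proof -
      have "1 + 1 / real k = real (Suc k) / real k"
        using k by (simp add: field_simps)
      then show ?thesis
        using ln_add_one_self_le_self[of "1 / real k"] k by (simp add: ln_div)
    qed
    ultimately have "real k * ln (real (Suc k)) \<le> real (Suc k) * ln (real k)"
      using k mult_left_mono[of "ln (real (Suc k))" "ln (real k) + 1 / real k" "real k"]
      by (simp add: algebra_simps)
    then show ?thesis using k by (simp add: divide_simps mult.commute)
  qed
  have tail: "\<bar>\<Sum>n=3..<M. ?f n\<bar> \<le> 2 * C * (ln (real 3) / real 3)" for M
    using dec by (intro abs_sum_le) auto
  have "\<bar>\<Sum>n=1..N. ?f n\<bar> \<le> \<bar>\<Sum>n=1..<3. ?f n\<bar> + 2 * C * (ln (real 3) / real 3)" for N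
  proof (cases "N < 2")
    case True
    then have "N = 0 \<or> N = 1" by auto
    then have "(\<Sum>n=1..N. ?f n) = 0" by auto
    then show ?thesis using C_nonneg by (simp add: add_nonneg_nonneg)
  next
    case False
    then have "(\<Sum>n=1..N. ?f n) = (\<Sum>n=1..<3. ?f n) + (\<Sum>n=3..<Suc N. ?f n)"
      by (subst sum.atLeastLessThan_concat) (auto simp: atLeastLessThanSuc_atLeastAtMost)
    then show ?thesis using tail[of "Suc N"] by linarith
  qed
  then show ?thesis by blast
qed

text \<open>Since \<open>ln n\<close> is the sum of \<open>mangoldt\<close> over the divisors of
  \<open>n\<close>, the bounded sum with \<open>ln\<close> equals the sum of
  \<open>\<chi> d * mangoldt d / d * S (N div d)\<close>. Replacing \<open>S (N div d)\<close> by
  \<open>L1\<close> costs a bounded amount by Chebyshev's bound, and \<open>L1\<close> can be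
  divided out.\<close>

lemma sum_mangoldt_over_bounded: "\<exists>B. \<forall>N. \<bar>\<Sum>d=1..N. \<chi> d * (mangoldt d / real d)\<bar> \<le> B"
proof -
  obtain D where D: "\<And>N. \<bar>\<Sum>n=1..N. \<chi> n * (ln (real n) / real n)\<bar> \<le> D"
    using sum_ln_over_bounded by blast
  define S where "S = (\<lambda>N. \<Sum>n=1..N. \<chi> n / real n)"
  define A where "A = (\<lambda>N. \<Sum>d=1..N. \<chi> d * (mangoldt d / real d))"
  have "\<bar>A N\<bar> \<le> (D + 8 * C) / \<bar>L1\<bar>" for N
  proof (cases "N = 0")
    case True
    have "0 \<le> D" using D[of 0] by simp
    then show ?thesis using True C_nonneg by (simp add: A_def)
  next
    case False
    have "(\<Sum>n=1..N. \<chi> n * (ln (real n) / real n)) =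
        (\<Sum>n=1..N. \<Sum>d | d dvd n. \<chi> d * (mangoldt d / real d) * (\<chi> (n div d) / real (n div d)))"
    proof (rule sum.cong)
      fix n assume n: "n \<in> {1..N}"
      have "\<chi> n * (ln (real n) / real n) = (\<Sum>d | d dvd n. \<chi> n * (mangoldt d / real n))"
        using mangoldt_sum[of n, where 'a = real] n by (simp flip: sum_distrib_left sum_divide_distrib)
      also have "\<dots> = (\<Sum>d | d dvd n. \<chi> d * (mangoldt d / real d) * (\<chi> (n div d) / real (n div d)))"
      proof (rule sum.cong)
        fix d assume "d \<in> {d. d dvd n}"
        then obtain e where "n = d * e" by auto
        then show "\<chi> n * (mangoldt d / real n) = \<chi> d * (mangoldt d / real d) * (\<chi> (n div d) / real (n div d))"
          using n by (simp add: mult)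
      qed auto
      finally show "\<chi> n * (ln (real n) / real n) = \<dots>" .
    qed auto
    also have "\<dots> = (\<Sum>d=1..N. \<Sum>e=1..N div d. \<chi> d * (mangoldt d / real d) * (\<chi> e / real e))"
      by (rule sum_divisors_swap)
    also have "\<dots> = (\<Sum>d=1..N. \<chi> d * (mangoldt d / real d) * S (N div d))"
      by (simp add: S_def sum_distrib_left)
    finally have ln_eq: "(\<Sum>n=1..N. \<chi> n * (ln (real n) / real n)) =
        (\<Sum>d=1..N. \<chi> d * (mangoldt d / real d) * S (N div d))" .
    have "L1 * A N - (\<Sum>n=1..N. \<chi> n * (ln (real n) / real n)) =
        (\<Sum>d=1..N. \<chi> d * (mangoldt d / real d) * (L1 - S (N div d)))"
      unfolding ln_eq A_def sum_distrib_left sum_subtractf[symmetric]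
      by (intro sum.cong) (simp_all add: right_diff_distrib diff_divide_distrib mult_ac)
    also have "\<bar>\<dots>\<bar> \<le> (\<Sum>d=1..N. 2 * C / real N * mangoldt d)"
    proof (intro order_trans[OF sum_abs] sum_mono)
      fix d assume d: "d \<in> {1..N}"
      \<comment> \<open>This turns the tail error of \<open>L1\<close> into a multiple of
        \<open>d / N\<close>; the \<open>d\<close> cancels and a Chebyshev sum over \<open>N\<close>
        remains.\<close>
      have "real N \<le> real d * real (Suc (N div d))"
      proof -
        have "N \<le> d * Suc (N div d)"
          using d dividend_less_times_div[of d N] by simp
        then show ?thesis by (metis of_nat_le_iff of_nat_mult)
      qed
      then have "2 * C / real (Suc (N div d)) \<le> 2 * C * real d / real N"
        using d C_nonneg mult_left_mono[of "real N" "real d * real (Suc (N div d))" "2 * C"]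
        by (simp add: divide_simps del: of_nat_Suc)
      with L1_diff_le[of "N div d"] have "\<bar>L1 - S (N div d)\<bar> \<le> 2 * C * real d / real N"
        unfolding S_def by linarith
      then have "\<bar>\<chi> d\<bar> * (mangoldt d / real d) * \<bar>L1 - S (N div d)\<bar> \<le> 1 * (mangoldt d / real d) * (2 * C * real d / real N)"
        using abs_le_1[of d] by (intro mult_mono) (auto simp: mangoldt_nonneg)
      also have "\<dots> = 2 * C / real N * mangoldt d"
        using d by simp
      finally show "\<bar>\<chi> d * (mangoldt d / real d) * (L1 - S (N div d))\<bar> \<le> 2 * C / real N * mangoldt d"
        by (simp add: abs_mult)
    qed
    also have "\<dots> = 2 * C / real N * (\<Sum>d=1..N. mangoldt d)"
      by (simp add: sum_distrib_left)
    also have "\<dots> \<le> 2 * C / real N * (4 * real N)"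
      using C_nonneg by (intro mult_left_mono sum_mangoldt_le) auto
    also have "\<dots> = 8 * C" using False by simp
    finally have "\<bar>L1 * A N\<bar> \<le> D + 8 * C"
      using D[of N] by linarith
    then show ?thesis
      using L1_nonzero by (simp add: abs_mult field_simps)
  qed
  then show ?thesis unfolding A_def by blast
qed

end

section \<open>Primes with prescribed Legendre symbols\<close>

lemma Legendre_range: "Legendre a p \<in> {-1, 0, 1}"
  by (simp add: Legendre_def)

lemma Legendre_cong:
  assumes "[a = b] (mod p)"
  shows "Legendre a p = Legendre b p"
  using assms unfolding Legendre_def QuadRes_def cong_def by simp

text \<open>By Euler's criterion both sides agree modulo \<open>p\<close>, and they differ by at
  most 2, which is less than \<open>p\<close>.\<close>

lemma Legendre_mult:
  fixes p :: nat
  assumes "prime p" "2 < p"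
  shows "Legendre (a * b) (int p) = Legendre a (int p) * Legendre b (int p)"
proof -
  let ?e = "(p - 1) div 2"
  have "[Legendre a (int p) * Legendre b (int p) = a ^ ?e * b ^ ?e] (mod int p)"
    by (intro cong_mult euler_criterion assms)
  then have "[Legendre (a * b) (int p) = Legendre a (int p) * Legendre b (int p)] (mod int p)"
    using euler_criterion[OF assms, of "a * b"] by (metis power_mult_distrib cong_sym cong_trans)
  then have dvd: "int p dvd Legendre (a * b) (int p) - Legendre a (int p) * Legendre b (int p)"
    by (simp add: cong_iff_dvd_diff)
  have "\<bar>Legendre (a * b) (int p) - Legendre a (int p) * Legendre b (int p)\<bar> \<le> 2"
    using Legendre_range[of "a * b" p] Legendre_range[of a p] Legendre_range[of b p] by auto
  then show ?thesis
    using dvd_imp_le_int[OF _ dvd] assms(2) by fastforce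
qed

lemma Legendre_power:
  fixes p :: nat
  assumes "prime p" "2 < p"
  shows "Legendre (a ^ k) (int p) = Legendre a (int p) ^ k"
proof (induction k)
  case 0
  have "\<not> int p dvd 1" using assms by simp
  moreover have "QuadRes (int p) 1"
    unfolding QuadRes_def by (rule exI[of _ 1]) simp
  ultimately show ?case by (simp add: Legendre_def cong_0_iff)
qed (simp add: Legendre_mult[OF assms])

text \<open>Squaring identifies 1 and \<open>p - 1\<close>, so it is not injective on the residues
  and hence not surjective. A missed residue is nonzero because 0 is a square.\<close>

lemma ex_quadratic_nonresidue:
  fixes p :: nat
  assumes "prime p" "2 < p"
  shows "\<exists>a::nat. Legendre (int a) (int p) = -1"
proof -
  let ?sq = "\<lambda>x::nat. x\<^sup>2 mod p"
  have "?sq (p - 1) = ?sq 1"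
  proof -
    have "[int (p - 1) = - 1] (mod int p)"
      using assms by (simp add: cong_iff_dvd_diff of_nat_diff)
    then have "[int (p - 1) ^ 2 = (- 1)\<^sup>2] (mod int p)"
      by (rule cong_pow)
    then have "[int ((p - 1)\<^sup>2) = int (1\<^sup>2)] (mod int p)"
      by simp
    then have "[(p - 1)\<^sup>2 = 1\<^sup>2] (mod p)"
      by (simp only: cong_int_iff)
    then show ?thesis
      by (simp only: cong_def)
  qed
  then have "\<not> inj_on ?sq {..<p}"
    using assms inj_onD[of ?sq "{..<p}" "p - 1" 1] by auto
  then have "?sq ` {..<p} \<noteq> {..<p}"
    by (metis eq_card_imp_inj_on finite_lessThan)
  moreover have "?sq ` {..<p} \<subseteq> {..<p}" using assms by auto
  ultimately obtain a where a: "a < p" "a \<notin> ?sq ` {..<p}" by blast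
  have "\<not> QuadRes (int p) (int a)"
  proof
    assume "QuadRes (int p) (int a)"
    then obtain y where y: "[y\<^sup>2 = int a] (mod int p)" by (auto simp: QuadRes_def)
    define x where "x = nat (y mod int p)"
    have x: "x < p" "int x = y mod int p"
      using assms by (auto simp: x_def nat_less_iff)
    have "[int x ^ 2 = int a] (mod int p)"
      using y unfolding x(2) cong_def by (simp add: power_mod)
    then have "[x\<^sup>2 = a] (mod p)"
      by (simp flip: cong_int_iff)
    then have "a = ?sq x" using a(1) by (simp add: cong_def)
    then show False using a(2) x(1) by blast
  qed
  moreover have "\<not> [int a = 0] (mod int p)"
  proof
    assume "[int a = 0] (mod int p)"
    then have "a = 0" using a(1) by (auto simp: cong_0_iff dest: dvd_imp_le)
    then show False using a(2) assms imageI[of 0 "{..<p}" ?sq] by simp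
  qed
  ultimately show ?thesis
    by (intro exI[of _ a]) (simp add: Legendre_def)
qed

section \<open>Products of Legendre symbols as real characters\<close>

lemma abs_sum_periodic_le:
  fixes f :: "nat \<Rightarrow> real"
  assumes period: "\<And>n. f (n + P) = f n" and zero: "(\<Sum>k<P. f k) = 0"
    and le: "\<And>n. \<bar>f n\<bar> \<le> 1" and "P > 0"
  shows "\<bar>\<Sum>k<n. f k\<bar> \<le> real P"
proof (induction n rule: less_induct)
  case (less n)
  show ?case
  proof (cases "n < P")
    case True
    have "\<bar>\<Sum>k<n. f k\<bar> \<le> (\<Sum>k<n. 1)"
      by (intro order_trans[OF sum_abs] sum_mono le)
    then show ?thesis using True by simp
  next
    case False
    then have "(\<Sum>k<n. f k) = (\<Sum>k<P. f k) + (\<Sum>k=P..<n. f k)"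
      by (subst sum.union_disjoint[symmetric]) (auto intro!: sum.cong)
    also have "(\<Sum>k=P..<n. f k) = (\<Sum>k<n-P. f (k + P))"
      using False by (intro sum.reindex_bij_witness[of _ "\<lambda>k. k + P" "\<lambda>k. k - P"]) auto
    finally have "(\<Sum>k<n. f k) = (\<Sum>k<n-P. f k)"
      using zero period by simp
    then show ?thesis using less[of "n - P"] False \<open>P > 0\<close> by simp
  qed
qed

text \<open>Multiplication by the unit \<open>a\<close> permutes the residues, so the sum equals
  \<open>f a\<close> times itself.\<close>

lemma sum_multiplicative_period_eq_0:
  fixes f :: "nat \<Rightarrow> real"
  assumes mult: "\<And>m n. f (m * n) = f m * f n" and mod: "\<And>n. f (n mod P) = f n"
    and a: "coprime a P" "f a \<noteq> 1" and "P > 0"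
  shows "(\<Sum>k<P. f k) = 0"
proof -
  have inj: "inj_on (\<lambda>k. a * k mod P) {..<P}"
  proof (rule inj_onI)
    fix x y assume xy: "x \<in> {..<P}" "y \<in> {..<P}" "a * x mod P = a * y mod P"
    then have "[a * x = a * y] (mod P)" by (simp add: cong_def)
    then have "[x = y] (mod P)" using a(1) by (simp add: cong_mult_lcancel_nat)
    then show "x = y" using xy by (auto intro: cong_less_modulus_unique_nat)
  qed
  then have "(\<lambda>k. a * k mod P) ` {..<P} = {..<P}"
    using \<open>P > 0\<close> by (intro endo_inj_surj) auto
  then have "(\<Sum>k<P. f k) = (\<Sum>k\<in>(\<lambda>k. a * k mod P) ` {..<P}. f k)"
    by simp
  also have "\<dots> = (\<Sum>k<P. f (a * k mod P))"
    using inj by (simp add: sum.reindex)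
  also have "\<dots> = f a * (\<Sum>k<P. f k)"
    by (simp add: mod mult sum_distrib_left)
  finally show ?thesis using a(2) by simp
qed

text \<open>For a finite set of odd primes this is the Jacobi symbol modulo \<open>\<Prod>T\<close>;
  the empty set gives the constant 1.\<close>

definition legendre_prod :: "nat set \<Rightarrow> nat \<Rightarrow> real" where
  "legendre_prod T n = (\<Prod>q\<in>T. real_of_int (Legendre (int n) (int q)))"

lemma real_character_legendre_prod:
  assumes T: "finite T" "T \<noteq> {}" "\<And>q. q \<in> T \<Longrightarrow> prime q \<and> 2 < q"
  shows "real_character (legendre_prod T) (real (\<Prod>T))"
proof
  have one: "Legendre 1 (int q) = 1" if "q \<in> T" for q
    using Legendre_power[of q 1 0] T(3)[OF that] by simp
  show "legendre_prod T 1 = 1"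
    using one by (simp add: legendre_prod_def)
  show mult: "legendre_prod T (m * n) = legendre_prod T m * legendre_prod T n" for m n
    using T(3) by (simp add: legendre_prod_def Legendre_mult prod.distrib)
  show range: "legendre_prod T n \<in> {-1, 0, 1}" for n
    unfolding legendre_prod_def using T(1)
  proof (induction rule: finite_induct)
    case (insert q T)
    then show ?case using Legendre_range[of "int n" "int q"] by auto
  qed auto
  have P: "\<Prod>T > 0"
    using T by (intro prod_pos) auto
  have cong: "legendre_prod T m = legendre_prod T n" if "[m = n] (mod \<Prod>T)" for m n
    unfolding legendre_prod_def
  proof (rule prod.cong)
    fix q assume "q \<in> T"
    then have "[m = n] (mod q)"
      using that T(1) by (meson cong_dvd_modulus_nat dvd_prod_eqI)
    then show "real_of_int (Legendre (int m) (int q)) = real_of_int (Legendre (int n) (int q))"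
      using Legendre_cong[of "int m" "int n" "int q"] by (simp add: cong_int_iff)
  qed auto
  obtain q where q: "q \<in> T" using T(2) by blast
  obtain r where r: "Legendre (int r) (int q) = -1"
    using ex_quadratic_nonresidue T(3)[OF q] by blast
  have "\<forall>i\<in>T. \<forall>j\<in>T. i \<noteq> j \<longrightarrow> coprime i j"
    using T(3) primes_coprime by blast
  \<comment> \<open>By the Chinese remainder theorem \<open>a\<close> is a nonresidue at the single
    prime \<open>q\<close> and 1 at the others, so the product takes the value -1 at
    \<open>a\<close>.\<close>
  then obtain a where a: "\<And>i. i \<in> T \<Longrightarrow> [a = (if i = q then r else 1)] (mod i)"
    using chinese_remainder_nat[OF T(1), of "\<lambda>i. i" "\<lambda>i. if i = q then r else 1"] by blast
  have leg: "Legendre (int a) (int i) = (if i = q then -1 else 1)" if "i \<in> T" for i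
    using a[OF that] Legendre_cong[of "int a" "int (if i = q then r else 1)" "int i"] r one[OF that]
    by (auto simp: cong_int_iff split: if_splits)
  have "legendre_prod T a = (\<Prod>i\<in>T. if i = q then -1 else 1)"
    unfolding legendre_prod_def by (intro prod.cong) (auto simp: leg)
  then have "legendre_prod T a \<noteq> 1"
    using T(1) q by simp
  moreover have "coprime a (\<Prod>T)"
  proof (rule prod_coprime_right)
    fix i assume i: "i \<in> T"
    have "\<not> i dvd a"
      using leg[OF i] by (auto simp: Legendre_def cong_0_iff split: if_splits)
    then show "coprime a i"
      using T(3)[OF i] prime_imp_coprime coprime_commute by blast
  qed
  ultimately have "(\<Sum>k<\<Prod>T. legendre_prod T k) = 0"
    using P by (intro sum_multiplicative_period_eq_0 mult cong) (auto simp: cong_def)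
  then show "\<bar>\<Sum>k<n. legendre_prod T k\<bar> \<le> real (\<Prod>T)" for n
  proof (intro abs_sum_periodic_le[OF cong _ _ P])
    show "[k + \<Prod>T = k] (mod \<Prod>T)" for k by (simp add: cong_def)
    show "\<bar>legendre_prod T k\<bar> \<le> 1" for k using range[of k] by auto
  qed
qed

section \<open>Infinitely many primes that are nonresidues modulo each given prime\<close>

theorem infinite_primes_nonresidue:
  fixes Q :: "nat set"
  assumes Q: "finite Q" "\<And>q. q \<in> Q \<Longrightarrow> prime q \<and> 2 < q"
  shows "infinite {p :: nat. prime p \<and> (\<forall>q\<in>Q. Legendre (int p) (int q) = -1)}"
proof
  define R where "R = {p :: nat. prime p \<and> (\<forall>q\<in>Q. Legendre (int p) (int q) = -1)}"
  assume "finite {p :: nat. prime p \<and> (\<forall>q\<in>Q. Legendre (int p) (int q) = -1)}"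
  \<comment> \<open>\<open>Q\<close> is joined to \<open>R\<close> because a power of some
    \<open>q\<close> in \<open>Q\<close> has symbol 0 at \<open>q\<close> and may survive in
    \<open>f\<close>.\<close>
  then have S: "finite (Q \<union> R)" "\<And>p. p \<in> Q \<union> R \<Longrightarrow> prime p"
    using Q by (auto simp: R_def)
  define f :: "nat \<Rightarrow> real" where "f = (\<lambda>n. \<Prod>q\<in>Q. 1 - real_of_int (Legendre (int n) (int q)))"
  have factor: "0 \<le> 1 - real_of_int (Legendre a q) \<and> 1 - real_of_int (Legendre a q) \<le> 2" for a q
    using Legendre_range[of a q] by auto
  have f_bounds: "0 \<le> f n" "f n \<le> 2 ^ card Q" for n
  proof -
    show "0 \<le> f n"
      unfolding f_def by (intro prod_nonneg) (use factor in auto)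
    have "f n \<le> (\<Prod>q\<in>Q. 2)"
      unfolding f_def by (intro prod_mono conjI) (use factor in auto)
    then show "f n \<le> 2 ^ card Q" by simp
  qed
  have support: "aprimedivisor n \<in> Q \<union> R" if n: "primepow n" "f n \<noteq> 0" for n
  proof -
    obtain p k where pk: "prime p" "k > 0" "n = p ^ k"
      using n(1) by (auto simp: primepow_def)
    have "p \<in> Q \<union> R"
    proof (cases "p \<in> Q")
      case False
      have "Legendre (int p) (int q) = -1" if q: "q \<in> Q" for q
      proof -
        \<comment> \<open>A symbol 1 would make a factor of \<open>f n\<close> vanish. So the symbol
          of \<open>p\<close> is not 1 either, and it is not 0 since \<open>p\<close> differs from
          \<open>q\<close>.\<close>
        have "Legendre (int n) (int q) \<noteq> 1"
          using n(2) q Q(1) by (auto simp: f_def)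
        then have "Legendre (int p) (int q) \<noteq> 1"
          using Legendre_power[of q "int p" k] Q(2)[OF q] pk(3) by auto
        moreover have "\<not> q dvd p"
          using False q Q(2)[OF q] pk(1) primes_dvd_imp_eq by blast
        ultimately show ?thesis
          by (auto simp: Legendre_def cong_0_iff)
      qed
      then show ?thesis using pk(1) by (simp add: R_def)
    qed auto
    then show ?thesis
      using pk by (simp add: aprimedivisor_prime_power)
  qed
  have upper: "(\<Sum>n=1..N. f n * (mangoldt n / real n)) \<le> 2 ^ card Q * (\<Sum>p\<in>Q\<union>R. ln (real p))" for N
  proof -
    have "(\<Sum>n=1..N. f n * (mangoldt n / real n)) =
        (\<Sum>n | n \<in> {1..N} \<and> primepow n \<and> aprimedivisor n \<in> Q \<union> R. f n * (mangoldt n / real n))"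
      using support by (intro sum.mono_neutral_right) (auto simp: mangoldt_def)
    also have "\<dots> \<le> (\<Sum>n | n \<in> {1..N} \<and> primepow n \<and> aprimedivisor n \<in> Q \<union> R. 2 ^ card Q * (mangoldt n / real n))"
      using f_bounds by (intro sum_mono mult_right_mono) (auto simp: mangoldt_nonneg)
    also have "\<dots> \<le> 2 ^ card Q * (\<Sum>p\<in>Q\<union>R. ln (real p))"
      unfolding sum_distrib_left[symmetric] using S
      by (intro mult_left_mono sum_mangoldt_over_primepow_le) auto
    finally show ?thesis .
  qed
  have "\<exists>B. \<forall>N. \<bar>\<Sum>n=1..N. legendre_prod X n * (mangoldt n / real n)\<bar> \<le> B" if "X \<in> Pow Q - {{}}" for X
  proof -
    interpret real_character "legendre_prod X" "real (\<Prod>X)"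
      using that Q by (intro real_character_legendre_prod) (auto intro: finite_subset)
    show ?thesis by (rule sum_mangoldt_over_bounded)
  qed
  then obtain B where B: "\<And>X N. X \<in> Pow Q - {{}} \<Longrightarrow> \<bar>\<Sum>n=1..N. legendre_prod X n * (mangoldt n / real n)\<bar> \<le> B X"
    by metis
  have lower: "ln (real N) - 1 - (\<Sum>X\<in>Pow Q - {{}}. B X) \<le> (\<Sum>n=1..N. f n * (mangoldt n / real n))"
    if "N > 0" for N
  proof -
    let ?A = "\<lambda>X. \<Sum>n=1..N. legendre_prod X n * (mangoldt n / real n)"
    have f_eq: "f n = (\<Sum>X\<in>Pow Q. (-1) ^ card X * legendre_prod X n)" for n
      using prod_add[OF Q(1), of "\<lambda>q. - real_of_int (Legendre (int n) (int q))" "\<lambda>_. 1"]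
      by (simp add: f_def legendre_prod_def prod_uminus)
    have "(\<Sum>n=1..N. f n * (mangoldt n / real n)) =
        (\<Sum>n=1..N. \<Sum>X\<in>Pow Q. (-1) ^ card X * (legendre_prod X n * (mangoldt n / real n)))"
      unfolding f_eq sum_distrib_right by (simp only: mult.assoc)
    also have "\<dots> = (\<Sum>X\<in>Pow Q. (-1) ^ card X * ?A X)"
      by (subst sum.swap) (simp only: sum_distrib_left)
    also have "\<dots> = ?A {} + (\<Sum>X\<in>Pow Q - {{}}. (-1) ^ card X * ?A X)"
      using Q(1) by (subst sum.remove[of _ "{}"]) auto
    finally have eq: "(\<Sum>n=1..N. f n * (mangoldt n / real n)) =
        ?A {} + (\<Sum>X\<in>Pow Q - {{}}. (-1) ^ card X * ?A X)" .
    have "\<bar>\<Sum>X\<in>Pow Q - {{}}. (-1) ^ card X * ?A X\<bar> \<le> (\<Sum>X\<in>Pow Q - {{}}. B X)"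
      using B by (intro order_trans[OF sum_abs] sum_mono) (simp add: abs_mult power_abs)
    moreover have "ln (real N) - 1 \<le> ?A {}"
      using sum_mangoldt_over_ge[OF that] by (simp add: legendre_prod_def)
    ultimately show ?thesis unfolding eq by linarith
  qed
  \<comment> \<open>Chosen so that \<open>lower\<close> and \<open>upper\<close> together give
    \<open>ln N \<le> D\<close> for all positive \<open>N\<close>.\<close>
  define D where "D = 2 ^ card Q * (\<Sum>p\<in>Q\<union>R. ln (real p)) + 1 + (\<Sum>X\<in>Pow Q - {{}}. B X)"
  obtain N where N: "exp D < real N"
    using reals_Archimedean2 by blast
  then have "N > 0"
    using exp_gt_zero[of D] by (intro Nat.gr0I) auto
  then have "ln (real N) \<le> D"
    using lower[of N] upper[of N] by (simp add: D_def)
  moreover have "D < ln (real N)"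
    using N \<open>N > 0\<close> by (metis exp_ln exp_less_cancel_iff of_nat_0_less_iff)
  ultimately show False by simp
qed

section \<open>Parity of Fibonacci numbers and the coprimality claim\<close>

lemma odd_fib_iff: "odd (fib n) \<longleftrightarrow> \<not> 3 dvd n"
proof -
  have fib3: "fib 3 = 2" by (simp add: numeral_3_eq_3)
  \<comment> \<open>With \<open>fib 3 = 2\<close> the parity question becomes the strong
    divisibility of Fibonacci numbers.\<close>
  have "gcd (fib n) 2 = fib (gcd n 3)"
    by (simp add: fib_gcd fib3)
  moreover have "gcd n 3 = (if 3 dvd n then 3 else 1)"
  proof (cases "3 dvd n")
    case True
    then show ?thesis by (simp add: gcd_nat.absorb2)
  next
    case False
    have "prime (3 :: nat)" by simp
    then have "coprime n 3"
      using prime_imp_coprime[of 3 n] False by (simp add: coprime_commute)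
    then show ?thesis unfolding coprime_iff_gcd_eq_1 using False by simp
  qed
  ultimately have "gcd (fib n) 2 = (if 3 dvd n then 2 else 1)"
    using fib3 by simp
  then show ?thesis
    unfolding coprime_right_2_iff_odd[symmetric] coprime_iff_gcd_eq_1 by simp
qed

theorem theorem2:
  fixes k l s M :: nat
  assumes "k > 0" and "l > 0" and "odd l"
    and "s > 0" and "\<not> [s = 1] (mod 3)"
    and "M = fib (50 * s + 25)"
  shows "infinite {p :: nat. prime p \<and> gcd ((int k)\<^sup>2 - (int p) ^ l) (int M) = 1}"
proof -
  have "M > 0" using assms(6) by (simp add: fib_neq_0_nat)
  \<comment> \<open>Modulo 3 the index is \<open>2 * s + 1\<close>, which vanishes exactly for
    \<open>s\<close> congruent to 1.\<close>
  have "\<not> 3 dvd 50 * s + 25"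
    using assms(5) unfolding cong_def by presburger
  then have "odd M" using odd_fib_iff assms(6) by blast
  have Q: "prime q \<and> 2 < q" if "q \<in> prime_factors M" for q
    using that \<open>odd M\<close> prime_ge_2_nat[of q] by (cases "q = 2") (auto simp: in_prime_factors_iff)
  have "gcd ((int k)\<^sup>2 - (int p) ^ l) (int M) = 1"
    if p: "\<And>q. q \<in> prime_factors M \<Longrightarrow> Legendre (int p) (int q) = -1" for p
  proof (rule ccontr)
    assume "gcd ((int k)\<^sup>2 - (int p) ^ l) (int M) \<noteq> 1"
    then have "\<bar>gcd ((int k)\<^sup>2 - (int p) ^ l) (int M)\<bar> \<noteq> 1"
      by (simp only: abs_gcd_int not_False_eq_True)
    then obtain r where r: "prime r" "r dvd gcd ((int k)\<^sup>2 - (int p) ^ l) (int M)"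
      by (rule prime_factor_int)
    define q where "q = nat r"
    have rq: "r = int q"
      using prime_ge_0_int[OF r(1)] by (simp add: q_def)
    have "prime q" using r(1) unfolding rq by simp
    have q_dvd: "int q dvd (int k)\<^sup>2 - (int p) ^ l" "int q dvd int M"
      using r(2) unfolding rq by (meson gcd_dvd1 gcd_dvd2 dvd_trans)+
    then have qM: "q \<in> prime_factors M"
      using \<open>prime q\<close> \<open>M > 0\<close> by (simp add: in_prime_factors_iff)
    have "[(int k)\<^sup>2 = int p ^ l] (mod int q)"
      using q_dvd(1) by (simp only: cong_iff_dvd_diff)
    then have "Legendre ((int k)\<^sup>2) (int q) = Legendre (int p ^ l) (int q)"
      by (rule Legendre_cong)
    \<comment> \<open>For odd \<open>l\<close> the right-hand side is -1, which no square can
      equal.\<close>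
    then have "(Legendre (int k) (int q))\<^sup>2 = Legendre (int p) (int q) ^ l"
      using Q[OF qM] by (simp only: Legendre_power)
    then have "(Legendre (int k) (int q))\<^sup>2 = -1"
      using p[OF qM] \<open>odd l\<close> by simp
    then show False
      using zero_le_power2[of "Legendre (int k) (int q)"] by linarith
  qed
  then have "{p. prime p \<and> (\<forall>q\<in>prime_factors M. Legendre (int p) (int q) = -1)} \<subseteq>
      {p. prime p \<and> gcd ((int k)\<^sup>2 - (int p) ^ l) (int M) = 1}"
    by blast
  then show ?thesis
    using infinite_primes_nonresidue[of "prime_factors M"] Q infinite_super by blast
qed

end
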